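(* Let $G$ be a connected graph of order $n\ge 2$ and let $\Gamma$ be a family of nontrivial graphs such that $V(F)=V$ for every $F\in\Gamma$. Consider any function $h:V(G)\to\Gamma$. Then $$\lambda(G\circ_h\Gamma)=\min\{\lambda(G)|V|^2,\ \delta(G\circ_h\Gamma)\}.$$
   Context: All graphs are finite and simple. A graph is nontrivial if it has at least two vertices. For a graph $G$, a family of graphs $\Gamma$ and a function $h:V(G)\to\Gamma$, the product $G\circ_h\Gamma$ is the graph with vertex set $\bigcup_{a\in V(G)}\{(a,x): x\in V(h(a))\}$ in which $(a,x)(b,y)$ is an edge if and only if either $ab\in E(G)$, or $a=b$ and $xy\in E(h(a))$. The edge-connectivity $\lambda(G)$ is the minimum size of a set of edges whose deletion disconnects $G$, and $\delta(G)$ is the minimum degree of $G$. *)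

theory Defs
  imports "Graph_Theory.Digraph_Component" "HOL-Library.FuncSet"
begin

text \<open>
  A finite simple graph is a \<^locale>\<open>pair_graph\<close>: a finite, symmetric, loop-free
  relation on a finite vertex set. An undirected edge \<open>uv\<close> is thus represented by the
  two arcs \<open>(u, v)\<close> and \<open>(v, u)\<close>, so edges are counted and deleted as the two-element
  sets \<open>{u, v}\<close>, not as arcs.
\<close>

definition edges :: "'a pair_pre_digraph \<Rightarrow> 'a set set" where
  "edges G = {{u, v} | u v. (u, v) \<in> parcs G}"

definition delete_edges :: "'a pair_pre_digraph \<Rightarrow> 'a set set \<Rightarrow> 'a pair_pre_digraph" where
  "delete_edges G S =
     \<lparr>pverts = pverts G, parcs = {(u, v). (u, v) \<in> parcs G \<and> {u, v} \<notin> S}\<rparr>"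

text \<open>
  The minimum ranges over a nonempty set as soon as \<open>G\<close> has two vertices, by
  \<open>disconnecting_sets_nonempty\<close> below; for smaller graphs the value is unspecified.
\<close>

definition edge_connectivity :: "'a pair_pre_digraph \<Rightarrow> nat" where
  "edge_connectivity G =
     Min {card S | S. S \<subseteq> edges G \<and> \<not> connected (delete_edges G S)}"

text \<open>In a \<^locale>\<open>pair_graph\<close> the out-degree of a vertex is the number of its neighbours.\<close>

definition min_degree :: "'a pair_pre_digraph \<Rightarrow> nat" where
  "min_degree G = Min {out_degree G v | v. v \<in> pverts G}"

text \<open>
  The product of \<open>G\<close> with the family \<open>\<Gamma>\<close> depends on \<open>\<Gamma>\<close> only through the values of
  \<open>h : V(G) \<rightarrow> \<Gamma>\<close>. The endpoints are required to be vertices explicitly, because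
  \<open>ab \<in> E(G)\<close> alone says nothing about \<open>x\<close> and \<open>y\<close>.
\<close>

definition graph_product ::
  "'a pair_pre_digraph \<Rightarrow> ('a \<Rightarrow> 'b pair_pre_digraph) \<Rightarrow> ('a \<times> 'b) pair_pre_digraph" where
  "graph_product G h =
     \<lparr>pverts = (\<Union>a\<in>pverts G. {(a, x) | x. x \<in> pverts (h a)}),
      parcs = {((a, x), (b, y)) | a x b y.
                 a \<in> pverts G \<and> x \<in> pverts (h a) \<and> b \<in> pverts G \<and> y \<in> pverts (h b) \<and>
                 ((a, b) \<in> parcs G \<or> (a = b \<and> (x, y) \<in> parcs (h a)))}\<rparr>"

lemma pair_graph_graph_product:
  assumes G: "pair_graph G" and h: "\<And>a. a \<in> pverts G \<Longrightarrow> pair_graph (h a)"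
  shows "pair_graph (graph_product G h)"
proof -
  interpret G: pair_graph G by (fact G)
  let ?P = "graph_product G h"
  have pv: "pverts ?P = Sigma (pverts G) (\<lambda>a. pverts (h a))"
    by (auto simp: graph_product_def)
  have fin: "finite (pverts ?P)"
    unfolding pv using h by (intro finite_SigmaI G.pair_finite_verts)
      (simp add: pair_graph_def pair_digraph_def pair_fin_digraph_def pair_fin_digraph_axioms_def)
  have sub: "parcs ?P \<subseteq> pverts ?P \<times> pverts ?P"
    by (auto simp: graph_product_def)
  have symG: "(b, a) \<in> parcs G" if "(a, b) \<in> parcs G" for a b
    using G.pair_sym_arcs that by (auto simp: symmetric_def elim: symE)
  have symh: "(y, x) \<in> parcs (h a)" if "a \<in> pverts G" "(x, y) \<in> parcs (h a)" for a x y
  proof -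
    interpret H: pair_graph "h a" using h that by blast
    show ?thesis using H.pair_sym_arcs that by (auto simp: symmetric_def elim: symE)
  qed
  have loopG: "(a, a) \<notin> parcs G" for a
    using G.pair_no_loops by fastforce
  have looph: "(x, x) \<notin> parcs (h a)" if "a \<in> pverts G" for a x
  proof -
    interpret H: pair_graph "h a" using h that by blast
    show ?thesis using H.pair_no_loops by fastforce
  qed
  show ?thesis
  proof (unfold_locales, goal_cases)
    case (1 e) then show ?case using sub by auto
  next
    case (2 e) then show ?case using sub by auto
  next
    case 3 then show ?case by (fact fin)
  next
    case 4 then show ?case using finite_subset[OF sub] fin by blast
  next
    case (5 e) then show ?case using loopG looph by (auto simp: graph_product_def)
  next
    case 6 then show ?case
      by (auto simp: graph_product_def symmetric_def sym_def intro: symG symh)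
  qed
qed

lemma disconnecting_sets_nonempty:
  assumes "card (pverts G) \<ge> 2"
  shows "edges G \<in> {S. S \<subseteq> edges G \<and> \<not> connected (delete_edges G S)}"
proof -
  have empty: "parcs (delete_edges G (edges G)) = {}"
    by (auto simp: delete_edges_def edges_def)
  obtain u v where uv: "u \<in> pverts G" "v \<in> pverts G" "u \<noteq> v"
    using assms by (metis card_le_Suc0_iff_eq card.infinite not_less_eq_eq numeral_2_eq_2 zero_le)
  have "parcs (mk_symmetric (delete_edges G (edges G))) = {}"
    using empty by (simp add: mk_symmetric_def)
  then have "\<not> u \<rightarrow>\<^sup>*\<^bsub>mk_symmetric (delete_edges G (edges G))\<^esub> v"
    unfolding reachable_def with_proj_simps using uv(3) by (auto elim: rtrancl_on.cases)
  then show ?thesis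
    using uv by (auto simp: connected_def strongly_connected_def mk_symmetric_def delete_edges_def)
qed

end

theory Submission
  imports Defs
begin

text \<open>
  Edge-connectivity is the least size of an edge cut \<open>(X, -X)\<close>. In the product, a cut along the
  fibres over \<open>A \<subseteq> V(G)\<close> has \<open>|V|\<^sup>2\<close> times as many edges as the cut of \<open>G\<close> along \<open>A\<close>.
  If instead \<open>X\<close> splits the fibre over some \<open>a\<close> into two nonempty parts, the smaller one of size
  \<open>k\<close>, then each neighbour of \<open>a\<close> accounts for at least \<open>k|V|\<close> cut edges. For \<open>k \<ge> 2\<close> the bound
  \<open>k deg(a)|V| \<ge> deg(a)|V| + |V|\<close> exceeds the degree of any vertex over \<open>a\<close>; for \<open>k = 1\<close> the smaller
  part is a single \<open>(a, x)\<close>, and the cut edges inside the fibre supply the missing \<open>deg(x)\<close>.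
\<close>

section \<open>Edge cuts and connectedness\<close>

definition arc_cut :: "'a pair_pre_digraph \<Rightarrow> 'a set \<Rightarrow> ('a \<times> 'a) set" where
  "arc_cut G X = {(u, v). (u, v) \<in> parcs G \<and> u \<in> X \<and> v \<notin> X}"

lemma arc_cut_subset: "arc_cut G X \<subseteq> parcs G"
  by (auto simp: arc_cut_def)

lemma pair_graph_sym: "pair_graph G \<Longrightarrow> sym (parcs G)"
  by (simp add: pair_graph_def pair_pseudo_graph_def pair_sym_digraph_def
      pair_sym_digraph_axioms_def symmetric_def)

lemma finite_pverts: "pair_graph G \<Longrightarrow> finite (pverts G)"
  by (simp add: pair_graph_def pair_digraph_def pair_fin_digraph_def pair_fin_digraph_axioms_def)

lemma finite_parcs: "pair_graph G \<Longrightarrow> finite (parcs G)"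
  by (simp add: pair_graph_def pair_digraph_def pair_fin_digraph_def pair_fin_digraph_axioms_def)

lemma finite_arc_cut: "pair_graph G \<Longrightarrow> finite (arc_cut G X)"
  using finite_parcs arc_cut_subset finite_subset by metis

lemma pair_graph_parcsD:
  assumes "pair_graph G" "(u, v) \<in> parcs G"
  shows "u \<in> pverts G" "v \<in> pverts G" "u \<noteq> v" "(v, u) \<in> parcs G"
proof -
  interpret pair_graph G by (fact assms(1))
  show "u \<in> pverts G" "v \<in> pverts G" "u \<noteq> v" "(v, u) \<in> parcs G"
    using assms(2) wellformed' no_loops' arcs_symmetric by blast+
qed

lemma parcs_mk_symmetric:
  "sym (parcs G) \<Longrightarrow> parcs (mk_symmetric (with_proj G)) = parcs G"
  by (auto simp: mk_symmetric_def dest: symD)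

text \<open>Symmetry makes reachability in \<open>mk_symmetric\<close> the same as reachability
  along the arcs of \<open>G\<close>. The conjunct \<open>pverts G \<noteq> {}\<close> appears
  because strong connectedness includes nonemptiness.\<close>

lemma connected_iff_arc_cut:
  fixes G :: "'a pair_pre_digraph"
  assumes "sym (parcs G)"
  shows "connected G \<longleftrightarrow> pverts G \<noteq> {} \<and>
    (\<forall>X \<subseteq> pverts G. X \<noteq> {} \<longrightarrow> X \<noteq> pverts G \<longrightarrow> (\<exists>u\<in>X. \<exists>v\<in>pverts G - X. (u, v) \<in> parcs G))"
    (is "_ \<longleftrightarrow> _ \<and> ?cuts")
proof -
  have conn: "connected G \<longleftrightarrow> pverts G \<noteq> {} \<and>
      (\<forall>u\<in>pverts G. \<forall>v\<in>pverts G. (u, v) \<in> rtrancl_on (pverts G) (parcs G))"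
    using parcs_mk_symmetric[OF assms]
    by (simp add: connected_def strongly_connected_def reachable_def)
  have "(\<forall>u\<in>pverts G. \<forall>v\<in>pverts G. (u, v) \<in> rtrancl_on (pverts G) (parcs G)) \<longleftrightarrow> ?cuts"
    (is "?reach \<longleftrightarrow> _")
  proof
    assume reach: ?reach
    show ?cuts
    proof (intro allI impI)
      fix X assume X: "X \<subseteq> pverts G" "X \<noteq> {}" "X \<noteq> pverts G"
      then obtain u v where uv: "u \<in> X" "v \<in> pverts G" "v \<notin> X" by blast
      then have "(u, v) \<in> rtrancl_on (pverts G) (parcs G)" using reach X by blast
      \<comment> \<open>Invariant along the walk from \<open>u\<close>: either the current vertex is
        still in \<open>X\<close>, or some arc leads out of \<open>X\<close>.\<close>
      then have "v \<in> X \<or> (\<exists>u\<in>X. \<exists>v\<in>pverts G - X. (u, v) \<in> parcs G)"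
      proof (induction rule: rtrancl_on_induct)
        case base
        show ?case using uv(1) by (rule disjI1)
      next
        case (step y z)
        then show ?case by blast
      qed
      with uv show "\<exists>u\<in>X. \<exists>v\<in>pverts G - X. (u, v) \<in> parcs G" by blast
    qed
  next
    assume cuts: ?cuts
    show ?reach
    proof (intro ballI)
      fix u v assume uv: "u \<in> pverts G" "v \<in> pverts G"
      \<comment> \<open>No arc leaves the set of vertices reachable from \<open>u\<close>, so it
        cannot be a proper subset.\<close>
      let ?X = "{w \<in> pverts G. (u, w) \<in> rtrancl_on (pverts G) (parcs G)}"
      have "\<not> (\<exists>x\<in>?X. \<exists>y\<in>pverts G - ?X. (x, y) \<in> parcs G)"
        by (auto intro: rtrancl_on_into_rtrancl_on)
      moreover have "u \<in> ?X" using uv by auto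
      ultimately have "?X = pverts G" using cuts by blast
      with uv show "(u, v) \<in> rtrancl_on (pverts G) (parcs G)" by blast
    qed
  qed
  with conn show ?thesis by simp
qed

text \<open>Since \<open>{u, v} = {v, u}\<close>, deletion keeps the relation symmetric and the cut
  criterion applies to what is left. Hence a set of edges disconnects \<open>G\<close> exactly when
  it contains every edge of some cut.\<close>

lemma connected_delete_edges_iff:
  assumes "pair_graph G" "pverts G \<noteq> {}"
  shows "connected (delete_edges G S) \<longleftrightarrow>
    (\<forall>X \<subseteq> pverts G. X \<noteq> {} \<longrightarrow> X \<noteq> pverts G \<longrightarrow> (\<exists>(u, v)\<in>arc_cut G X. {u, v} \<notin> S))"
proof -
  have "sym (parcs (delete_edges G S))"
    using pair_graph_sym[OF assms(1)] by (auto simp: delete_edges_def sym_def insert_commute)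
  moreover have "(\<exists>u\<in>X. \<exists>v\<in>pverts G - X. (u, v) \<in> parcs (delete_edges G S)) \<longleftrightarrow>
      (\<exists>(u, v)\<in>arc_cut G X. {u, v} \<notin> S)" for X
    unfolding delete_edges_def arc_cut_def using pair_graph_parcsD(2)[OF assms(1)] by auto
  moreover have "pverts (delete_edges G S) = pverts G" by (simp add: delete_edges_def)
  ultimately show ?thesis
    using assms(2) connected_iff_arc_cut[of "delete_edges G S"] by simp
qed

text \<open>An edge across the cut has just one endpoint in \<open>X\<close>, so only one of its two
  arcs leaves \<open>X\<close>. Counting arcs of the cut therefore counts undirected edges.\<close>

lemma inj_on_arc_cut: "inj_on (\<lambda>(u, v). {u, v}) (arc_cut G X)"
  by (auto simp: inj_on_def arc_cut_def doubleton_eq_iff)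

section \<open>Edge-connectivity as the least size of a cut\<close>

lemma finite_edges: "pair_graph G \<Longrightarrow> finite (edges G)"
  by (rule finite_subset[of _ "(\<lambda>(u, v). {u, v}) ` parcs G"])
    (auto simp: edges_def finite_parcs)

lemma finite_disconnecting_cards:
  assumes "pair_graph G"
  shows "finite {card S | S. S \<subseteq> edges G \<and> \<not> connected (delete_edges G S)}"
proof -
  have "finite {S. S \<subseteq> edges G \<and> \<not> connected (delete_edges G S)}"
    by (rule finite_subset[of _ "Pow (edges G)"]) (use finite_edges[OF assms] in auto)
  then show ?thesis by simp
qed

lemma edge_connectivity_le_card_arc_cut:
  assumes "pair_graph G" "X \<subseteq> pverts G" "X \<noteq> {}" "X \<noteq> pverts G"
  shows "edge_connectivity G \<le> card (arc_cut G X)"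
proof -
  let ?S = "(\<lambda>(u, v). {u, v}) ` arc_cut G X"
  have "?S \<subseteq> edges G" by (auto simp: edges_def arc_cut_def)
  moreover have "\<not> connected (delete_edges G ?S)"
    using assms by (subst connected_delete_edges_iff) auto
  ultimately have "edge_connectivity G \<le> card ?S"
    unfolding edge_connectivity_def
    by (intro Min_le finite_disconnecting_cards assms) blast
  then show ?thesis by (simp add: card_image inj_on_arc_cut)
qed

text \<open>A minimum disconnecting set contains all edges of some cut, so that cut is no larger; it
  is no smaller either, because its own edges disconnect \<open>G\<close>.\<close>

lemma edge_connectivity_attained:
  assumes "pair_graph G" "card (pverts G) \<ge> 2"
  obtains X where "X \<subseteq> pverts G" "X \<noteq> {}" "X \<noteq> pverts G"
    "edge_connectivity G = card (arc_cut G X)"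
proof -
  have "edge_connectivity G \<in> {card S | S. S \<subseteq> edges G \<and> \<not> connected (delete_edges G S)}"
    unfolding edge_connectivity_def
    using disconnecting_sets_nonempty[OF assms(2)]
    by (intro Min_in finite_disconnecting_cards assms) blast
  then obtain S where S: "edge_connectivity G = card S" "S \<subseteq> edges G"
    "\<not> connected (delete_edges G S)" by blast
  have "pverts G \<noteq> {}" using assms(2) by auto
  with S(3) assms(1) obtain X where X: "X \<subseteq> pverts G" "X \<noteq> {}" "X \<noteq> pverts G"
    "\<forall>(u, v)\<in>arc_cut G X. {u, v} \<in> S"
    by (subst (asm) connected_delete_edges_iff) blast+
  have "card (arc_cut G X) \<le> card S"
    by (rule card_inj_on_le[OF inj_on_arc_cut])
      (use X(4) S(2) finite_edges[OF assms(1)] finite_subset in auto)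
  with edge_connectivity_le_card_arc_cut[OF assms(1) X(1-3)] S(1) X that show ?thesis by simp
qed

text \<open>Reversing arcs exchanges the two cuts. This serves the case where the smaller part of a
  split fibre lies outside \<open>X\<close>.\<close>

lemma card_arc_cut_compl:
  assumes "pair_graph G"
  shows "card (arc_cut G (pverts G - X)) = card (arc_cut G X)"
proof -
  have "arc_cut G (pverts G - X) = prod.swap ` arc_cut G X"
    using pair_graph_parcsD[OF assms] by (force simp: arc_cut_def)
  then show ?thesis by (simp add: card_image)
qed

section \<open>Degrees and cuts around a single vertex\<close>

lemma out_degree_conv_Image: "out_degree (with_proj G) v = card (parcs G `` {v})"
proof -
  have "out_arcs (with_proj G) v = Pair v ` (parcs G `` {v})" by (auto simp: out_arcs_def)
  then show ?thesis by (simp add: out_degree_def card_image inj_on_def)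
qed

lemma card_arc_cut_singleton:
  assumes "pair_graph G"
  shows "card (arc_cut G {v}) = out_degree (with_proj G) v"
proof -
  have "arc_cut G {v} = out_arcs (with_proj G) v"
    by (auto simp: arc_cut_def out_arcs_def dest: pair_graph_parcsD(3)[OF assms])
  then show ?thesis by (simp add: out_degree_def)
qed

lemma min_degree_le:
  assumes "pair_graph G" "v \<in> pverts G"
  shows "min_degree G \<le> out_degree (with_proj G) v"
  unfolding min_degree_def
  by (rule Min_le) (use assms finite_pverts in \<open>auto simp: setcompr_eq_image\<close>)

lemma min_degree_attained:
  assumes "pair_graph G" "pverts G \<noteq> {}"
  obtains v where "v \<in> pverts G" "min_degree G = out_degree (with_proj G) v"
proof -
  have "min_degree G \<in> {out_degree (with_proj G) v | v. v \<in> pverts G}"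
    unfolding min_degree_def
    by (rule Min_in) (use assms finite_pverts in \<open>auto simp: setcompr_eq_image\<close>)
  with that show ?thesis by blast
qed

lemma singleton_neq_if_card_ge_2: "card A \<ge> 2 \<Longrightarrow> {a} \<noteq> A"
  by auto

text \<open>The cut around a vertex of minimum degree is proper because there is a second
  vertex.\<close>

lemma edge_connectivity_le_min_degree:
  assumes "pair_graph G" "card (pverts G) \<ge> 2"
  shows "edge_connectivity G \<le> min_degree G"
proof -
  have "pverts G \<noteq> {}" using assms(2) by auto
  with assms(1) obtain v where v: "v \<in> pverts G" "min_degree G = out_degree (with_proj G) v"
    using min_degree_attained by blast
  have "{v} \<noteq> pverts G" using assms(2) by (rule singleton_neq_if_card_ge_2)
  with edge_connectivity_le_card_arc_cut[OF assms(1), of "{v}"] v show ?thesis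
    by (simp add: card_arc_cut_singleton[OF assms(1)])
qed

section \<open>The product: degrees and cuts\<close>

locale graph_family =
  fixes G :: "'a pair_pre_digraph" and h :: "'a \<Rightarrow> 'b pair_pre_digraph" and V :: "'b set"
  assumes G: "pair_graph G"
    and h: "a \<in> pverts G \<Longrightarrow> pair_graph (h a)"
    and pverts_h: "a \<in> pverts G \<Longrightarrow> pverts (h a) = V"
    and finite_V: "finite V"
begin

abbreviation P :: "('a \<times> 'b) pair_pre_digraph" where
  "P \<equiv> graph_product G h"

lemma P: "pair_graph P"
  using G h by (rule pair_graph_graph_product)

lemma pverts_P: "pverts P = pverts G \<times> V"
  by (auto simp: graph_product_def pverts_h)

lemma parcs_h:
  assumes "a \<in> pverts G" "(x, y) \<in> parcs (h a)"
  shows "x \<in> V" "y \<in> V"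
  using pair_graph_parcsD(1,2)[OF h assms(2)] pverts_h assms(1) by auto

lemma parcs_P: "((a, x), (b, y)) \<in> parcs P \<longleftrightarrow>
    (a, b) \<in> parcs G \<and> x \<in> V \<and> y \<in> V \<or> a = b \<and> a \<in> pverts G \<and> (x, y) \<in> parcs (h a)"
  by (auto simp: graph_product_def pverts_h dest: pair_graph_parcsD(1,2)[OF G] parcs_h)

text \<open>The neighbours of \<open>(a, x)\<close> are the whole fibres over the neighbours of
  \<open>a\<close> and the neighbours inside its own fibre; these are disjoint since
  \<open>G\<close> has no loops.\<close>

lemma out_degree_P:
  assumes "a \<in> pverts G" "x \<in> V"
  shows "out_degree (with_proj P) (a, x) =
    out_degree (with_proj G) a * card V + out_degree (with_proj (h a)) x"
proof -
  let ?N = "(parcs G `` {a}) \<times> V" and ?M = "{a} \<times> (parcs (h a) `` {x})"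
  have "parcs P `` {(a, x)} = ?N \<union> ?M"
    using assms by (auto simp: parcs_P)
  moreover have "?N \<inter> ?M = {}" by (auto dest: pair_graph_parcsD(3)[OF G])
  moreover have "finite ?N" "finite ?M"
    using finite_parcs[OF G] finite_parcs[OF h[OF assms(1)]] finite_V
    by (auto intro!: finite_Image)
  ultimately show ?thesis
    by (simp add: out_degree_conv_Image card_Un_disjoint card_cartesian_product)
qed

text \<open>Each arc of \<open>G\<close> leaving \<open>A\<close> lifts to all pairs of points in
  the two fibres, while arcs inside a fibre never leave \<open>A \<times> V\<close>.\<close>

lemma card_arc_cut_fibres:
  "card (arc_cut P (A \<times> V)) = card (arc_cut G A) * (card V)\<^sup>2"
proof -
  have "arc_cut P (A \<times> V) =
      (\<lambda>((a, b), (x, y)). ((a, x), (b, y))) ` (arc_cut G A \<times> (V \<times> V))" (is "_ = ?f ` _")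
  proof (intro set_eqI)
    fix e :: "('a \<times> 'b) \<times> 'a \<times> 'b"
    obtain a x b y where e: "e = ((a, x), (b, y))" by (metis prod.exhaust)
    have "e \<in> arc_cut P (A \<times> V) \<longleftrightarrow> (a, b) \<in> arc_cut G A \<and> x \<in> V \<and> y \<in> V"
      by (auto simp: e arc_cut_def parcs_P dest: parcs_h)
    also have "\<dots> \<longleftrightarrow> e \<in> ?f ` (arc_cut G A \<times> (V \<times> V))"
      unfolding e image_iff by force
    finally show "e \<in> arc_cut P (A \<times> V) \<longleftrightarrow> e \<in> ?f ` (arc_cut G A \<times> (V \<times> V))" .
  qed
  moreover have "inj ?f" by (auto simp: inj_def)
  ultimately show ?thesis
    by (simp add: card_image inj_on_subset card_cartesian_product power2_eq_square)
qed

text \<open>The fibres over \<open>a\<close> and a neighbour \<open>b\<close> are completely joined.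
  Each point over \<open>b\<close> is therefore separated from all of \<open>W\<close> or from all
  of \<open>V - W\<close>, hence from at least \<open>k\<close> points over
  \<open>a\<close>.\<close>

lemma card_arc_cut_split_fibre:
  assumes a: "a \<in> pverts G" and W: "W = {x \<in> V. (a, x) \<in> X}"
    and k: "k \<le> card W" "k \<le> card (V - W)"
  shows "out_degree (with_proj G) a * (k * card V) + card (arc_cut (h a) W) \<le> card (arc_cut P X)"
proof -
  define N where "N = parcs G `` {a}"
  define U where "U b = {y \<in> V. (b, y) \<in> X}" for b
  \<comment> \<open>The cut edges between the fibres over \<open>a\<close> and \<open>b\<close>,
    oriented out of \<open>X\<close>: the second piece starts over \<open>b\<close>, in
    \<open>U b\<close>.\<close>
  define C where "C b = (\<lambda>(x, y). ((a, x), (b, y))) ` (W \<times> (V - U b)) \<union>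
    (\<lambda>(x, y). ((b, y), (a, x))) ` ((V - W) \<times> U b)" for b
  define D where "D = (\<lambda>(x, y). ((a, x), (a, y))) ` arc_cut (h a) W"
  have aN: "a \<notin> N" by (auto simp: N_def dest: pair_graph_parcsD(3)[OF G])
  have finN: "finite N" using finite_parcs[OF G] by (auto simp: N_def)
  have finU: "finite (U b)" for b using finite_V by (auto simp: U_def)
  have finW: "finite W" using finite_V by (auto simp: W)
  have finC: "finite (C b)" for b using finW finU finite_V by (auto simp: C_def)
  have finD: "finite D" using finite_arc_cut[OF h[OF a]] by (auto simp: D_def)
  have C: "k * card V \<le> card (C b)" if "b \<in> N" for b
  proof -
    have "a \<noteq> b" using aN that by blast
    then have "card (C b) = card W * card (V - U b) + card (V - W) * card (U b)"
      unfolding C_def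
      by (subst card_Un_disjoint)
        (use finW finU finite_V in
          \<open>auto simp: card_image inj_on_def card_cartesian_product\<close>)
    moreover have "card V = card (V - U b) + card (U b)"
      using card_Diff_subset[OF finU, of b V] card_mono[OF finite_V, of "U b"]
      by (auto simp: U_def)
    then have "k * card V = k * card (V - U b) + k * card (U b)"
      by (metis distrib_left)
    ultimately show ?thesis using k by (simp add: add_mono mult_le_mono1)
  qed
  have "card N * (k * card V) + card (arc_cut (h a) W) \<le> (\<Sum>b\<in>N. card (C b)) + card D"
  proof -
    have "card D = card (arc_cut (h a) W)"
      unfolding D_def by (rule card_image) (auto simp: inj_on_def)
    moreover have "card N * (k * card V) \<le> (\<Sum>b\<in>N. card (C b))"
      using sum_mono[of N "\<lambda>_. k * card V", OF C] by simp
    ultimately show ?thesis by simp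
  qed
  also have "\<dots> = card (\<Union> (C ` N) \<union> D)"
  proof -
    \<comment> \<open>Every arc in \<open>C b\<close> joins the fibre over \<open>a\<close> to the
      one over \<open>b\<close>. As \<open>a\<close> is not in \<open>N\<close>, these sets are
      disjoint for different \<open>b\<close>, and disjoint from \<open>D\<close>, whose arcs stay
      over \<open>a\<close>.\<close>
    have "card (\<Union> (C ` N)) = (\<Sum>b\<in>N. card (C b))"
      by (rule card_UN_disjoint) (use finN finC aN in \<open>auto simp: C_def\<close>)
    moreover have "\<Union> (C ` N) \<inter> D = {}" using aN by (auto simp: C_def D_def)
    ultimately show ?thesis using finN finC finD by (simp add: card_Un_disjoint)
  qed
  also have "\<dots> \<le> card (arc_cut P X)"
  proof (rule card_mono[OF finite_arc_cut[OF P]])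
    have "C b \<subseteq> arc_cut P X" if "b \<in> N" for b
      using that
      by (auto simp: C_def N_def U_def W arc_cut_def parcs_P dest: pair_graph_parcsD(4)[OF G])
    moreover have "D \<subseteq> arc_cut P X"
      using a by (auto simp: D_def W arc_cut_def parcs_P dest: parcs_h)
    ultimately show "\<Union> (C ` N) \<union> D \<subseteq> arc_cut P X" by blast
  qed
  finally show ?thesis by (simp add: out_degree_conv_Image N_def)
qed

lemma min_degree_le_card_arc_cut:
  assumes deg: "out_degree (with_proj G) a \<ge> 1"
    and a: "a \<in> pverts G" and x: "x \<in> V" "(a, x) \<in> X" and y: "y \<in> V" "(a, y) \<notin> X"
  shows "min_degree P \<le> card (arc_cut P X)"
proof -
  define W where "W = {x \<in> V. (a, x) \<in> X}"
  define k where "k = min (card W) (card (V - W))"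
  have bound: "out_degree (with_proj G) a * (k * card V) + card (arc_cut (h a) W)
      \<le> card (arc_cut P X)"
    by (rule card_arc_cut_split_fibre[OF a W_def]) (auto simp: k_def)
  have min_deg: "min_degree P \<le> out_degree (with_proj G) a * card V + out_degree (with_proj (h a)) z"
    if "z \<in> V" for z
    using min_degree_le[OF P, of "(a, z)"] out_degree_P[OF a that] that a pverts_P by simp
  have "W \<noteq> {}" "V - W \<noteq> {}" using x y by (auto simp: W_def)
  moreover have fin: "finite W" "finite (V - W)" using finite_V by (auto simp: W_def)
  ultimately have "k \<ge> 1" by (auto simp: k_def Suc_le_eq card_gt_0_iff)
  show ?thesis
  proof (cases "k = 1")
    case True
    \<comment> \<open>One part of the fibre is a single vertex \<open>z\<close>. Up to
      complementation, the cut inside the fibre is the one around \<open>z\<close>, and its size is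
      the degree of \<open>z\<close> in \<open>h a\<close>.\<close>
    then consider "card W = 1" | "card (V - W) = 1" by (auto simp: k_def min_def split: if_splits)
    then obtain z where z: "z \<in> V" "card (arc_cut (h a) W) = card (arc_cut (h a) {z})"
    proof cases
      case 1
      then obtain z where "W = {z}" by (auto simp: card_1_singleton_iff)
      then show ?thesis using that[of z] by (auto simp: W_def)
    next
      case 2
      then obtain z where "V - W = {z}" by (auto simp: card_1_singleton_iff)
      then show ?thesis
        using that[of z] card_arc_cut_compl[OF h[OF a], of W] pverts_h[OF a] by auto
    qed
    then show ?thesis
      using min_deg[OF z(1)] bound True card_arc_cut_singleton[OF h[OF a], of z] by simp
  next
    case False
    have "out_degree (with_proj (h a)) x \<le> card V"
      unfolding out_degree_conv_Image
      using parcs_h(2)[OF a] by (intro card_mono finite_V) auto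
    \<comment> \<open>Since \<open>a\<close> has a neighbour, the degree inside the fibre fits into
      a second copy of \<open>out_degree G a * card V\<close>; this yields the factor 2, which is at
      most \<open>k\<close>.\<close>
    also have "\<dots> \<le> out_degree (with_proj G) a * card V" using deg by simp
    finally have "min_degree P \<le> out_degree (with_proj G) a * (2 * card V)"
      using min_deg[OF x(1)] by simp
    also have "\<dots> \<le> out_degree (with_proj G) a * (k * card V)"
      using False \<open>k \<ge> 1\<close> by (intro mult_le_mono) auto
    finally show ?thesis using bound by simp
  qed
qed

section \<open>The edge-connectivity of the product\<close>

lemma edge_connectivity_P:
  assumes conn: "connected G" and cardG: "card (pverts G) \<ge> 2" and cardV: "card V \<ge> 1"
  shows "edge_connectivity P = min (edge_connectivity G * (card V)\<^sup>2) (min_degree P)"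
proof (rule antisym)
  have "V \<noteq> {}" using cardV by auto
  have "2 * 1 \<le> card (pverts G) * card V" using cardG cardV by (rule mult_le_mono)
  then have cardP: "card (pverts P) \<ge> 2" by (simp add: pverts_P card_cartesian_product)
  obtain A where A: "A \<subseteq> pverts G" "A \<noteq> {}" "A \<noteq> pverts G"
    "edge_connectivity G = card (arc_cut G A)"
    using edge_connectivity_attained[OF G cardG] .
  have "edge_connectivity P \<le> card (arc_cut P (A \<times> V))"
    by (rule edge_connectivity_le_card_arc_cut[OF P])
      (use A \<open>V \<noteq> {}\<close> in \<open>auto simp: pverts_P\<close>)
  then have "edge_connectivity P \<le> edge_connectivity G * (card V)\<^sup>2"
    by (simp add: card_arc_cut_fibres A(4))
  then show "edge_connectivity P \<le> min (edge_connectivity G * (card V)\<^sup>2) (min_degree P)"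
    using edge_connectivity_le_min_degree[OF P cardP] by simp
  obtain X where X: "X \<subseteq> pverts P" "X \<noteq> {}" "X \<noteq> pverts P"
    "edge_connectivity P = card (arc_cut P X)"
    using edge_connectivity_attained[OF P cardP] .
  show "min (edge_connectivity G * (card V)\<^sup>2) (min_degree P) \<le> edge_connectivity P"
  \<comment> \<open>A minimum cut \<open>X\<close> either splits some fibre or is a union of whole
    fibres.\<close>
  proof (cases "\<exists>a x y. (a, x) \<in> X \<and> y \<in> V \<and> (a, y) \<notin> X")
    case True
    then obtain a x y where axy: "(a, x) \<in> X" "y \<in> V" "(a, y) \<notin> X" by blast
    then have ax: "a \<in> pverts G" "x \<in> V" using X(1) pverts_P by auto
    have "{a} \<noteq> pverts G" using cardG by (rule singleton_neq_if_card_ge_2)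
    \<comment> \<open>Connectedness applied to the proper vertex set \<open>{a}\<close> provides a
      neighbour of \<open>a\<close>.\<close>
    then have "parcs G `` {a} \<noteq> {}"
      using conn ax by (subst (asm) connected_iff_arc_cut[OF pair_graph_sym[OF G]]) auto
    then have "out_degree (with_proj G) a \<ge> 1"
      using finite_parcs[OF G]
      by (auto simp: out_degree_conv_Image Suc_le_eq card_gt_0_iff intro!: finite_Image)
    from min_degree_le_card_arc_cut[OF this ax axy] show ?thesis using X(4) by simp
  next
    case False
    \<comment> \<open>With no fibre split, \<open>X\<close> is determined by its projection to
      \<open>G\<close>, and its cut is the lift of the cut along \<open>B\<close>.\<close>
    define B where "B = fst ` X"
    have "X = B \<times> V" using False X(1) by (force simp: B_def pverts_P)
    moreover from this X have "B \<subseteq> pverts G" "B \<noteq> {}" "B \<noteq> pverts G"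
      by (auto simp: B_def pverts_P)
    ultimately show ?thesis
      using edge_connectivity_le_card_arc_cut[OF G, of B] card_arc_cut_fibres[of B] X(4)
      by (simp add: min.coboundedI1)
  qed
qed

end

theorem theorem2p9:
  fixes G :: "'a pair_pre_digraph"
    and \<Gamma> :: "'b pair_pre_digraph set"
    and V :: "'b set"
    and h :: "'a \<Rightarrow> 'b pair_pre_digraph"
  assumes "pair_graph G" and "connected G" and "card (pverts G) \<ge> 2"
    and "\<And>F. F \<in> \<Gamma> \<Longrightarrow> pair_graph F"
    and "\<And>F. F \<in> \<Gamma> \<Longrightarrow> card (pverts F) \<ge> 2"
    and "\<And>F. F \<in> \<Gamma> \<Longrightarrow> pverts F = V"
    and "h \<in> pverts G \<rightarrow> \<Gamma>"
  shows "edge_connectivity (graph_product G h) =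
           min (edge_connectivity G * (card V)\<^sup>2) (min_degree (graph_product G h))"
proof -
  obtain a where "a \<in> pverts G" using assms(3) by fastforce
  then have "h a \<in> \<Gamma>" using assms(7) by blast
  then have "card V \<ge> 2" using assms(5,6) by metis
  \<comment> \<open>Infinite sets have cardinality 0 by convention, so the lower bound on
    \<open>card V\<close> forces finiteness.\<close>
  then have "finite V" using card.infinite by fastforce
  interpret graph_family G h V
    using assms(1,4,6) \<open>finite V\<close> funcset_mem[OF assms(7)] by (intro graph_family.intro) auto
  show ?thesis using assms(2,3) \<open>card V \<ge> 2\<close> by (intro edge_connectivity_P) auto
qed

end
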